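(* Let $D$ be any $\bullet/\circ/+$-diagram (with stones colored black iff they are uncrossings). Every sequence of corrective flips starting from $D$ terminates, and it terminates in a Go-diagram.
   Context: Fix $0<k<n$. A Ferrers shape $\lambda$ is the set of unit boxes Northwest of a lattice path from the Northeast to the Southwest corner of a $k$-row, $(n-k)$-column rectangle; path steps labelled $1,\dots,n$ from the Northeast corner. $b^{in}$ is the set of boxes weakly right of and weakly below $b$. A $\bullet/\circ/+$-diagram fills the boxes with black stones, white stones and pluses. Pipe dream: stones become crossing tiles (bottom exits top, right exits left), pluses elbow tiles (bottom exits left, right exits top); the pipe entering at Southeast boundary step $i$ carries label $i$ and flows Northwest. A crossing tile is a crossing if the pipe from below has larger label than the pipe from the right, else an uncrossing. Stones are colored black iff they are uncrossings. $s_i=(i,i+1)$; the top-left box is labelled $s_{n-k}$; the box right of an $s_i$-box is labelled $s_{i-1}$, the box below it $s_{i+1}$; $s_b$ is $b$'s label. A reading order numbers boxes increasing upward and leftward; $u_{b^{in}}$ is the product of $s_c$ over stone boxes $c\in b^{in}$ in increasing reading order; $u_b=s_b$ if $b$ has a stone, else identity. $D$ is a Go-diagram if each box $b$ contains a black stone iff $\ell(u_{b^{in}}u_bs_b)<\ell(u_{b^{in}}u_b)$. A box not containing a black stone but satisfying this inequality violates the distinguished property. Corrective flip: let $b$ contain a plus that violates the distinguished property; the two pipes entering $b$ have previously crossed; let $c$ be the box (a white stone) where they last crossed before reaching $b$, and let the uncrossing partner of $c$, if it exists, be the first box after $c$ (further Northwest) at which these two pipes meet in a crossing tile. A corrective flip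 exchanges the plus in $b$ with the stone in either $c$ or its uncrossing partner, then recolors all stones so that a stone is black iff it is an uncrossing. *)

theory Defs
  imports "HOL-Combinatorics.Transposition"
begin

text \<open>
  Boxes are pairs (row, column), counted from 1, with row 1 at the top and column 1 on the left.
  A lattice path with steps 1, ..., n from the Northeast to the Southwest corner of the rectangle
  is given by the set S of the labels of its South steps; the other steps go West. The rectangle
  has k = card S rows and n - k columns.
\<close>

type_synonym box = "nat \<times> nat"

definition lattice_path :: "nat \<Rightarrow> nat \<Rightarrow> nat set \<Rightarrow> bool" where
  "lattice_path n k S \<longleftrightarrow> S \<subseteq> {1..n} \<and> card S = k"

text \<open>
  The point reached after t steps, as its distances from the top and from the left side of the
  rectangle (the latter is the number of West steps still to come).
\<close>

definition path_point :: "nat \<Rightarrow> nat set \<Rightarrow> nat \<Rightarrow> nat \<times> nat" where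
  "path_point n S t = (card {i \<in> S. i \<le> t}, card {i \<in> {1..n} - S. t < i})"

text \<open>
  The box (r, c) has the lattice point (r, c) as its Southeast corner; it is Northwest of the path
  iff that corner is weakly Northwest of some point of the path.
\<close>

definition ferrers :: "nat \<Rightarrow> nat set \<Rightarrow> box set" where
  "ferrers n S = {(r, c). 1 \<le> r \<and> 1 \<le> c \<and>
     (\<exists>t\<le>n. r \<le> fst (path_point n S t) \<and> c \<le> snd (path_point n S t))}"

definition south_step_in_row :: "nat \<Rightarrow> nat set \<Rightarrow> nat \<Rightarrow> nat" where
  "south_step_in_row n S r = (THE i. i \<in> S \<and> fst (path_point n S i) = r)"

definition west_step_in_column :: "nat \<Rightarrow> nat set \<Rightarrow> nat \<Rightarrow> nat" where
  "west_step_in_column n S c =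
     (THE i. i \<in> {1..n} - S \<and> snd (path_point n S (i - 1)) = c)"

text \<open>The set written b with superscript ``in''; it contains b itself.\<close>

definition in_boxes :: "nat \<Rightarrow> nat set \<Rightarrow> box \<Rightarrow> box set" where
  "in_boxes n S b = {c \<in> ferrers n S. fst b \<le> fst c \<and> snd b \<le> snd c}"

text \<open>A pipe through both x and y, x different from y, visits x first iff \<^term>\<open>box_before x y\<close>.\<close>

definition box_before :: "box \<Rightarrow> box \<Rightarrow> bool" where
  "box_before x y \<longleftrightarrow> x \<noteq> y \<and> fst y \<le> fst x \<and> snd y \<le> snd x"

datatype entry = Black | White | Plus

text \<open>Only the values of a diagram on the boxes of the shape matter.\<close>

type_synonym diagram = "box \<Rightarrow> entry"

definition is_stone :: "diagram \<Rightarrow> box \<Rightarrow> bool" where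
  "is_stone D b \<longleftrightarrow> D b \<noteq> Plus"


subsection \<open>Pipe dreams\<close>

text \<open>
  The labels of the pipes entering the box (r, c) from the right and from below, traced back
  against the direction of flow: a pipe leaving a stone to the left entered it from the right, a
  pipe leaving a plus to the left entered it from below, and similarly for the top.
\<close>

lemma ferrers_bound:
  assumes "(r, c) \<in> ferrers n S"
  shows "r + c \<le> 2 * n + 1"
proof -
  from assms obtain t where t: "t \<le> n" "r \<le> card {i \<in> S. i \<le> t}"
    "c \<le> card {i \<in> {1..n} - S. t < i}"
    by (auto simp: ferrers_def path_point_def)
  have "card {i \<in> S. i \<le> t} \<le> card {0..t}"
    by (rule card_mono) auto
  moreover have "card {i \<in> {1..n} - S. t < i} \<le> card {1..n}"
    by (rule card_mono) auto
  ultimately show ?thesis using t by simp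
qed

function pipe_from_right :: "nat \<Rightarrow> nat set \<Rightarrow> diagram \<Rightarrow> nat \<Rightarrow> nat \<Rightarrow> nat"
  and pipe_from_below :: "nat \<Rightarrow> nat set \<Rightarrow> diagram \<Rightarrow> nat \<Rightarrow> nat \<Rightarrow> nat" where
  "pipe_from_right n S D r c =
     (if (r, Suc c) \<in> ferrers n S
      then if is_stone D (r, Suc c)
           then pipe_from_right n S D r (Suc c)
           else pipe_from_below n S D r (Suc c)
      else south_step_in_row n S r)"
| "pipe_from_below n S D r c =
     (if (Suc r, c) \<in> ferrers n S
      then if is_stone D (Suc r, c)
           then pipe_from_below n S D (Suc r) c
           else pipe_from_right n S D (Suc r) c
      else west_step_in_column n S c)"
  by pat_completeness auto
termination
  by (relation "measure (\<lambda>x. case x of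
        Inl (n, S, D, r, c) \<Rightarrow> 2 * n + 2 - (r + c)
      | Inr (n, S, D, r, c) \<Rightarrow> 2 * n + 2 - (r + c))")
    (auto dest!: ferrers_bound)

declare pipe_from_right.simps [simp del] pipe_from_below.simps [simp del]

definition pipes_at :: "nat \<Rightarrow> nat set \<Rightarrow> diagram \<Rightarrow> box \<Rightarrow> nat set" where
  "pipes_at n S D b =
     {pipe_from_right n S D (fst b) (snd b), pipe_from_below n S D (fst b) (snd b)}"

definition is_crossing :: "nat \<Rightarrow> nat set \<Rightarrow> diagram \<Rightarrow> box \<Rightarrow> bool" where
  "is_crossing n S D b \<longleftrightarrow> b \<in> ferrers n S \<and> is_stone D b \<and>
     pipe_from_below n S D (fst b) (snd b) > pipe_from_right n S D (fst b) (snd b)"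

definition is_uncrossing :: "nat \<Rightarrow> nat set \<Rightarrow> diagram \<Rightarrow> box \<Rightarrow> bool" where
  "is_uncrossing n S D b \<longleftrightarrow> b \<in> ferrers n S \<and> is_stone D b \<and> \<not> is_crossing n S D b"

definition stones_colored :: "nat \<Rightarrow> nat set \<Rightarrow> diagram \<Rightarrow> bool" where
  "stones_colored n S D \<longleftrightarrow>
     (\<forall>b \<in> ferrers n S. is_stone D b \<longrightarrow> (D b = Black \<longleftrightarrow> is_uncrossing n S D b))"

definition recolor :: "nat \<Rightarrow> nat set \<Rightarrow> diagram \<Rightarrow> diagram" where
  "recolor n S D = (\<lambda>b. if b \<in> ferrers n S \<and> is_stone D b
                        then if is_uncrossing n S D b then Black else White
                        else D b)"


subsection \<open>Go-diagrams\<close>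

text \<open>
  Permutations of 1, ..., n are functions fixing all other numbers. The length is the Coxeter
  length: the least number of simple transpositions whose product is the given permutation.
\<close>

definition simple_transp :: "nat \<Rightarrow> nat \<Rightarrow> nat" where
  "simple_transp i = transpose i (Suc i)"

definition word_prod :: "nat list \<Rightarrow> nat \<Rightarrow> nat" where
  "word_prod is = foldr (\<circ>) (map simple_transp is) id"

definition coxeter_length :: "nat \<Rightarrow> (nat \<Rightarrow> nat) \<Rightarrow> nat" where
  "coxeter_length n w =
     (LEAST m. \<exists>is. length is = m \<and> set is \<subseteq> {1..<n} \<and> word_prod is = w)"

text \<open>No truncation happens here: columns of the rectangle are at most n - k.\<close>

definition box_label :: "nat \<Rightarrow> nat \<Rightarrow> box \<Rightarrow> nat" where
  "box_label n k b = (n - k) + fst b - snd b"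

definition reading_order :: "nat \<Rightarrow> nat set \<Rightarrow> (box \<Rightarrow> nat) \<Rightarrow> bool" where
  "reading_order n S rd \<longleftrightarrow>
     bij_betw rd (ferrers n S) {1..card (ferrers n S)} \<and>
     (\<forall>x \<in> ferrers n S. \<forall>y \<in> ferrers n S. box_before x y \<longrightarrow> rd x < rd y)"

definition u_in ::
    "nat \<Rightarrow> nat \<Rightarrow> nat set \<Rightarrow> (box \<Rightarrow> nat) \<Rightarrow> diagram \<Rightarrow> box \<Rightarrow> nat \<Rightarrow> nat" where
  "u_in n k S rd D b =
     word_prod (map (box_label n k)
       (sorted_key_list_of_set rd {c \<in> in_boxes n S b. is_stone D c}))"

definition u_box :: "nat \<Rightarrow> nat \<Rightarrow> diagram \<Rightarrow> box \<Rightarrow> nat \<Rightarrow> nat" where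
  "u_box n k D b = (if is_stone D b then simple_transp (box_label n k b) else id)"

definition length_drops ::
    "nat \<Rightarrow> nat \<Rightarrow> nat set \<Rightarrow> (box \<Rightarrow> nat) \<Rightarrow> diagram \<Rightarrow> box \<Rightarrow> bool" where
  "length_drops n k S rd D b \<longleftrightarrow>
     coxeter_length n (u_in n k S rd D b \<circ> u_box n k D b \<circ> simple_transp (box_label n k b))
       < coxeter_length n (u_in n k S rd D b \<circ> u_box n k D b)"

definition go_diagram ::
    "nat \<Rightarrow> nat \<Rightarrow> nat set \<Rightarrow> (box \<Rightarrow> nat) \<Rightarrow> diagram \<Rightarrow> bool" where
  "go_diagram n k S rd D \<longleftrightarrow>
     (\<forall>b \<in> ferrers n S. D b = Black \<longleftrightarrow> length_drops n k S rd D b)"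

definition violates_distinguished ::
    "nat \<Rightarrow> nat \<Rightarrow> nat set \<Rightarrow> (box \<Rightarrow> nat) \<Rightarrow> diagram \<Rightarrow> box \<Rightarrow> bool" where
  "violates_distinguished n k S rd D b \<longleftrightarrow>
     b \<in> ferrers n S \<and> D b \<noteq> Black \<and> length_drops n k S rd D b"


subsection \<open>Corrective flips\<close>

definition last_crossing :: "nat \<Rightarrow> nat set \<Rightarrow> diagram \<Rightarrow> box \<Rightarrow> box \<Rightarrow> bool" where
  "last_crossing n S D b c \<longleftrightarrow>
     box_before c b \<and> is_crossing n S D c \<and> pipes_at n S D c = pipes_at n S D b \<and>
     (\<forall>c'. box_before c' b \<and> is_crossing n S D c' \<and> pipes_at n S D c' = pipes_at n S D b
        \<longrightarrow> c' = c \<or> box_before c' c)"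

definition uncrossing_partner :: "nat \<Rightarrow> nat set \<Rightarrow> diagram \<Rightarrow> box \<Rightarrow> box \<Rightarrow> bool" where
  "uncrossing_partner n S D c d \<longleftrightarrow>
     box_before c d \<and> d \<in> ferrers n S \<and> is_stone D d \<and> pipes_at n S D d = pipes_at n S D c \<and>
     (\<forall>d'. box_before c d' \<and> d' \<in> ferrers n S \<and> is_stone D d' \<and>
           pipes_at n S D d' = pipes_at n S D c
        \<longrightarrow> d' = d \<or> box_before d d')"

definition corrective_flip ::
    "nat \<Rightarrow> nat \<Rightarrow> nat set \<Rightarrow> (box \<Rightarrow> nat) \<Rightarrow> diagram \<Rightarrow> diagram \<Rightarrow> bool" where
  "corrective_flip n k S rd D D' \<longleftrightarrow>
     (\<exists>b c x. D b = Plus \<and> violates_distinguished n k S rd D b \<and>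
        last_crossing n S D b c \<and> (x = c \<or> uncrossing_partner n S D c x) \<and>
        D' = recolor n S (D(b := D x, x := D b)))"

end

(*
  Read the boxes in the given order and let v_j be the product of the labels of the stones among
  the first j boxes. Then v_j lists the pipe labels along the boundary of these boxes, so the
  length condition at a box says that its pipe from below has a smaller label than its pipe from
  the right. A corrective flip composes v_j with the transposition of the two pipes (p q) for all
  j between the two exchanged boxes and changes no other v_j. In all these v_j the pair p < q is
  inverted, hence the sum of i * v_j(i) over all i and j strictly increases.
  When no flip is possible, no plus violates the distinguished property: two pipes that meet with
  their labels inverted have crossed before, and the boxes on a pipe form a chain, so a last
  crossing exists.
*)
theory Submission
  imports Defs "HOL-Combinatorics.Permutations"
begin

section \<open>Coxeter length and inversions\<close>

text \<open>Two facts explain why a local exchange has a global effect that can be controlled. A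
  stone multiplies on the right by s_i, but \<open>w \<circ> simple_transp i\<close> is also (w(i)
  w(i+1)) composed with w. Adding or removing a stone is thus a left multiplication by the
  transposition of the two pipes, and it survives all later right factors unchanged until a second
  exchange of the same pipes cancels it. Composing with (p q) when the larger value q stands at
  position a and p at a later position b changes the sum of i * w(i) by (b - a)(q - p), which is
  positive. The obstacle is that the Go condition at a box looks only at the boxes Southeast of it,
  while the sum needs one chain of permutations for the whole shape. The identification of products
  with pipe labels is therefore proved for every set of boxes closed towards Southeast. It is
  applied to three kinds of such sets: the boxes before b, the initial segments of the reading
  order, and the union of the boxes before x with those before y, in which two incomparable boxes
  can be compared.\<close>

lemma simple_transp_simps:
  "simple_transp i i = Suc i" "simple_transp i (Suc i) = i"
  "j \<noteq> i \<Longrightarrow> j \<noteq> Suc i \<Longrightarrow> simple_transp i j = j"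
  by (auto simp: simple_transp_def transpose_def)

lemma simple_transp_involutory: "simple_transp i (simple_transp i j) = j"
  by (simp add: simple_transp_def)

lemma comp_simple_transp_twice: "w \<circ> simple_transp i \<circ> simple_transp i = w"
  by (simp add: fun_eq_iff simple_transp_involutory)

text \<open>The excluded pair is the only one whose order the transposition reverses. Both the count
  of inversions and the tracking of two pipes rest on this.\<close>

lemma simple_transp_less:
  "x < y \<Longrightarrow> \<not> (x = i \<and> y = Suc i) \<Longrightarrow> simple_transp i x < simple_transp i y"
  by (auto simp: simple_transp_def transpose_def)

lemma simple_transp_permutes: "i \<in> {1..<n} \<Longrightarrow> simple_transp i permutes {1..n}"
  unfolding simple_transp_def by (rule permutes_swap_id) auto

lemma word_prod_Nil: "word_prod [] = id"
  by (simp add: word_prod_def)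

lemma word_prod_Cons: "word_prod (i # is) = simple_transp i \<circ> word_prod is"
  by (simp add: word_prod_def)

lemma word_prod_snoc: "word_prod (is @ [i]) = word_prod is \<circ> simple_transp i"
proof (induction "is")
  case Nil
  show ?case by (simp only: append_Nil word_prod_Cons word_prod_Nil comp_id id_comp)
next
  case (Cons j "is")
  then show ?case by (simp only: append_Cons word_prod_Cons comp_assoc)
qed

lemma word_prod_permutes: "set is \<subseteq> {1..<n} \<Longrightarrow> word_prod is permutes {1..n}"
proof (induction "is" rule: rev_induct)
  case (snoc i "is")
  then have "simple_transp i permutes {1..n}" by (intro simple_transp_permutes) simp
  with snoc show ?case unfolding word_prod_snoc by (intro permutes_compose) simp_all
qed (simp only: word_prod_Nil permutes_id)

definition inversions :: "nat \<Rightarrow> (nat \<Rightarrow> nat) \<Rightarrow> (nat \<times> nat) set" where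
  "inversions n w = {(a, b). 1 \<le> a \<and> a < b \<and> b \<le> n \<and> w b < w a}"

lemma finite_inversions [simp]: "finite (inversions n w)"
  by (rule finite_subset[of _ "{..n} \<times> {..n}"]) (auto simp: inversions_def)

lemma inversions_id [simp]: "inversions n id = {}"
  by (auto simp: inversions_def)

text \<open>Applying s_i to both positions matches the inversions of \<open>w\<close> with those of
  \<open>w \<circ> simple_transp i\<close> other than (i, i+1). The order inside each pair is kept
  because (i, i+1) is not an inversion of \<open>w\<close>.\<close>

lemma card_inversions_ascent:
  assumes "i \<in> {1..<n}" and "w i < w (Suc i)"
  shows "card (inversions n (w \<circ> simple_transp i)) = Suc (card (inversions n w))"
proof -
  let ?s = "simple_transp i"
  have rng: "1 \<le> ?s x" "?s x \<le> n" if "1 \<le> x" "x \<le> n" for x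
    using permutes_in_image[OF simple_transp_permutes[OF assms(1)], of x] that by auto
  have "inversions n (w \<circ> ?s) = insert (i, Suc i) (map_prod ?s ?s ` inversions n w)" (is "?L = ?R")
  proof
    show "?L \<subseteq> ?R"
    proof clarify
      fix a b assume ab: "(a, b) \<in> ?L" "(a, b) \<notin> map_prod ?s ?s ` inversions n w"
      show "a = i \<and> b = Suc i"
      proof (rule ccontr)
        assume "\<not> ?thesis"
        with ab have "(?s a, ?s b) \<in> inversions n w"
          using simple_transp_less[of a b i] rng[of a] rng[of b] by (auto simp: inversions_def)
        then have "map_prod ?s ?s (?s a, ?s b) \<in> map_prod ?s ?s ` inversions n w" by (rule imageI)
        with ab(2) show False by (simp add: simple_transp_involutory)
      qed
    qed
    show "?R \<subseteq> ?L"
    proof -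
      have "(?s a, ?s b) \<in> ?L" if "(a, b) \<in> inversions n w" for a b
      proof -
        from that assms(2) have "\<not> (a = i \<and> b = Suc i)" by (auto simp: inversions_def)
        with that show ?thesis
          using simple_transp_less[of a b i] rng[of a] rng[of b]
          by (auto simp: inversions_def simple_transp_involutory)
      qed
      then show ?thesis using assms by (auto simp: inversions_def simple_transp_simps)
    qed
  qed
  moreover have "(i, Suc i) \<notin> map_prod ?s ?s ` inversions n w"
  proof
    assume "(i, Suc i) \<in> map_prod ?s ?s ` inversions n w"
    then obtain a b where "(a, b) \<in> inversions n w" "?s a = i" "?s b = Suc i" by auto
    moreover from this have "a = Suc i" "b = i"
      by (metis simple_transp_involutory simple_transp_simps(1),
          metis simple_transp_involutory simple_transp_simps(2))
    ultimately show False by (simp add: inversions_def)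
  qed
  moreover have "inj (map_prod ?s ?s)"
    by (intro prod.inj_map) (simp_all add: simple_transp_def inj_transpose)
  then have "card (map_prod ?s ?s ` inversions n w) = card (inversions n w)"
    by (intro card_image) (auto intro: inj_on_subset)
  ultimately show ?thesis by simp
qed

lemma card_inversions_descent:
  assumes "i \<in> {1..<n}" and "w (Suc i) < w i"
  shows "Suc (card (inversions n (w \<circ> simple_transp i))) = card (inversions n w)"
  using card_inversions_ascent[of i n "w \<circ> simple_transp i"] assms
  by (simp add: comp_simple_transp_twice simple_transp_simps)

lemma card_inversions_word_prod_le:
  "set is \<subseteq> {1..<n} \<Longrightarrow> card (inversions n (word_prod is)) \<le> length is"
proof (induction "is" rule: rev_induct)
  case Nil
  show ?case unfolding word_prod_Nil inversions_id by simp
next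
  case (snoc i "is")
  let ?w = "word_prod is"
  have perm: "?w permutes {1..n}" and i: "i \<in> {1..<n}"
    using snoc.prems word_prod_permutes[of "is" n] by simp_all
  from permutes_inj[OF perm] have "?w i \<noteq> ?w (Suc i)" by (simp add: inj_eq)
  then consider "?w i < ?w (Suc i)" | "?w (Suc i) < ?w i" by linarith
  then have "card (inversions n (?w \<circ> simple_transp i)) \<le> length (is @ [i])"
  proof cases
    case 1
    with snoc card_inversions_ascent[OF i, of ?w] show ?thesis by simp
  next
    case 2
    with snoc card_inversions_descent[OF i, of ?w] show ?thesis by simp
  qed
  then show ?case by (simp only: word_prod_snoc)
qed

lemma permutes_no_descent_eq_id:
  assumes w: "w permutes {1..n}" and asc: "\<And>i. i \<in> {1..<n} \<Longrightarrow> w i < w (Suc i)"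
  shows "w = id"
proof -
  \<comment> \<open>The values on 1..n increase and start at 1 or more; all other arguments are
    fixed, so the bound extends to every natural number.\<close>
  have "i \<le> w i" for i
  proof (induction i)
    case (Suc i)
    then show ?case
    proof (cases "i \<in> {1..<n}")
      case False
      then show ?thesis
        using permutes_not_in[OF w, of "Suc i"] permutes_in_image[OF w, of "Suc i"]
        by (cases "i = 0"; cases "Suc i \<le> n") auto
    qed (use asc[of i] in simp)
  qed simp
  then show ?thesis
    by (intro permutes_natset_ge[OF w]) auto
qed

text \<open>Bubble sort: right multiplication at a descent removes exactly one inversion, and the
  removed letter becomes the last one of the word. Together with
  \<open>card_inversions_word_prod_le\<close>, where each letter adds at most one inversion, this
  determines the Coxeter length.\<close>

lemma permutes_as_word_prod:
  "w permutes {1..n} \<Longrightarrow>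
    \<exists>is. length is = card (inversions n w) \<and> set is \<subseteq> {1..<n} \<and> word_prod is = w"
proof (induction "card (inversions n w)" arbitrary: w rule: less_induct)
  case less
  show ?case
  proof (cases "\<exists>i\<in>{1..<n}. w (Suc i) < w i")
    case True
    then obtain i where i: "i \<in> {1..<n}" "w (Suc i) < w i" by blast
    let ?w = "w \<circ> simple_transp i"
    have "?w permutes {1..n}"
      by (intro permutes_compose simple_transp_permutes less.prems i)
    with less.hyps[of ?w] card_inversions_descent[OF i, symmetric] obtain "is"
      where "length is = card (inversions n ?w)" "set is \<subseteq> {1..<n}" "word_prod is = ?w"
      by auto
    with card_inversions_descent[OF i] i(1) show ?thesis
      by (intro exI[of _ "is @ [i]"]) (simp add: comp_simple_transp_twice word_prod_snoc)
  next
    case False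
    have "w = id"
    proof (rule permutes_no_descent_eq_id[OF less.prems])
      fix i assume "i \<in> {1..<n}"
      with False have "w i \<le> w (Suc i)" by force
      moreover have "w i \<noteq> w (Suc i)"
        using permutes_inj[OF less.prems] by (simp add: inj_eq)
      ultimately show "w i < w (Suc i)" by simp
    qed
    then show ?thesis by (intro exI[of _ "[]"]) (simp add: word_prod_Nil)
  qed
qed

lemma coxeter_length_eq_card_inversions:
  assumes "w permutes {1..n}"
  shows "coxeter_length n w = card (inversions n w)"
  unfolding coxeter_length_def
  by (rule Least_equality)
    (use permutes_as_word_prod[OF assms] card_inversions_word_prod_le in blast)+

lemma coxeter_length_drops_iff:
  assumes w: "w permutes {1..n}" and i: "i \<in> {1..<n}"
  shows "coxeter_length n (w \<circ> simple_transp i) < coxeter_length n w \<longleftrightarrow> w (Suc i) < w i"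
proof -
  have "w \<circ> simple_transp i permutes {1..n}"
    by (intro permutes_compose simple_transp_permutes w i)
  moreover have "w i \<noteq> w (Suc i)"
    using permutes_inj[OF w] by (simp add: inj_eq)
  ultimately show ?thesis
    using card_inversions_ascent[OF i, of w] card_inversions_descent[OF i, of w] w
    by (cases "w i < w (Suc i)") (auto simp: coxeter_length_eq_card_inversions)
qed

subsection \<open>Inverted pairs of values\<close>

text \<open>Conjugating s_i by \<open>w\<close> gives the transposition of the values at positions i
  and i+1. With pipe labels as values, this is the transposition of the two pipes entering a
  box.\<close>

lemma transpose_comp_eq_comp_simple_transp:
  assumes "inj w"
  shows "transpose (w i) (w (Suc i)) \<circ> w = w \<circ> simple_transp i"
proof
  fix x show "(transpose (w i) (w (Suc i)) \<circ> w) x = (w \<circ> simple_transp i) x"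
    using assms by (auto simp: simple_transp_def transpose_def inj_eq)
qed

text \<open>Stated through positions of values, because a pipe keeps its label while its position on
  the boundary moves. For arbitrary p and q it says only that q stands before p; it is an inversion
  when p < q.\<close>

definition inverted :: "(nat \<Rightarrow> nat) \<Rightarrow> nat \<Rightarrow> nat \<Rightarrow> bool" where
  "inverted w p q \<longleftrightarrow> inv w q < inv w p"

lemma inv_comp_simple_transp:
  assumes "bij w"
  shows "inv (w \<circ> simple_transp i) x = simple_transp i (inv w x)"
proof -
  have "bij (simple_transp i)" by (simp add: simple_transp_def)
  moreover have "inv (simple_transp i) = simple_transp i" by (simp add: simple_transp_def)
  ultimately show ?thesis using o_inv_distrib[of w "simple_transp i"] assms by simp
qed

text \<open>Two values can change their relative order only if they occupy the positions i and i+1,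
  by \<open>simple_transp_less\<close>.\<close>

lemma becomes_inverted:
  assumes w: "bij w" and "p \<noteq> q" and "inverted (w \<circ> simple_transp i) p q" "\<not> inverted w p q"
  shows "w i = p" "w (Suc i) = q"
proof -
  have "inv w p \<noteq> inv w q"
    using assms(2) by (metis bij_is_surj surj_f_inv_f w)
  then have "inv w p < inv w q" using assms(4) by (simp add: inverted_def)
  moreover have "\<not> simple_transp i (inv w p) < simple_transp i (inv w q)"
    using assms(3) by (simp add: inverted_def inv_comp_simple_transp[OF w])
  ultimately have "inv w p = i \<and> inv w q = Suc i"
    using simple_transp_less by blast
  then show "w i = p" "w (Suc i) = q"
    by (metis bij_is_surj surj_f_inv_f w)+
qed

lemma stops_inverted:
  assumes w: "bij w" and "inverted w p q" "\<not> inverted (w \<circ> simple_transp i) p q"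
  shows "w i = q" "w (Suc i) = p"
proof -
  have "inv w q = i \<and> inv w p = Suc i"
    using simple_transp_less[of "inv w q" "inv w p" i] assms
    by (auto simp: inverted_def inv_comp_simple_transp[OF w])
  then show "w i = q" "w (Suc i) = p"
    by (metis bij_is_surj surj_f_inv_f w)+
qed

lemma not_inverted_comp_simple_transp:
  "bij w \<Longrightarrow> \<not> inverted (w \<circ> simple_transp i) (w (Suc i)) (w i)"
  by (simp add: inverted_def inv_comp_simple_transp simple_transp_simps bij_is_inj)

text \<open>Rearrangement inequality: only the summands at the two positions a < b change, and
  moving the larger value to b gains (b - a)(q - p). The differences are named d and e in the proof
  to stay clear of truncated subtraction.\<close>

lemma weighted_sum_less_transpose:
  assumes w: "w permutes {1..n::nat}" and "p < q" "p \<in> {1..n}" "q \<in> {1..n}" and "inverted w p q"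
  shows "(\<Sum>i\<in>{1..n}. i * w i) < (\<Sum>i\<in>{1..n}. i * (transpose p q \<circ> w) i)"
proof -
  define a b where "a = inv w q" and "b = inv w p"
  have ab: "a < b" using assms by (simp add: a_def b_def inverted_def)
  have wab: "w a = q" "w b = p"
    using permutes_inverses(1)[OF w] by (simp_all add: a_def b_def)
  have "a \<in> {1..n}" "b \<in> {1..n}"
    using permutes_in_image[OF w, of a] permutes_in_image[OF w, of b] wab assms by simp_all
  then have split: "sum f {1..n} = sum f ({1..n} - {a, b}) + (f a + f b)" for f :: "nat \<Rightarrow> nat"
    using ab sum.subset_diff[of "{a, b}" "{1..n}" f] by simp
  have "(transpose p q \<circ> w) i = w i" if "i \<in> {1..n} - {a, b}" for i
  proof -
    have "w i \<noteq> w a" "w i \<noteq> w b" using that permutes_inj[OF w] by (simp_all add: inj_eq)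
    then show ?thesis using wab by simp
  qed
  then have "(\<Sum>i\<in>{1..n} - {a, b}. i * (transpose p q \<circ> w) i) = (\<Sum>i\<in>{1..n} - {a, b}. i * w i)"
    by (intro sum.cong) simp_all
  moreover have "a * q + b * p < a * p + b * q"
  proof -
    from ab obtain d where d: "b = a + d" "0 < d" using less_imp_add_positive by blast
    from \<open>p < q\<close> obtain e where e: "q = p + e" "0 < e" using less_imp_add_positive by blast
    have "0 < d * e" using d e by simp
    then show ?thesis unfolding d e by (simp add: algebra_simps)
  qed
  ultimately show ?thesis
    by (simp only: split o_apply wab transpose_apply_first transpose_apply_second)
qed

section \<open>Sorting by an injective key\<close>

lemma insort_key_greatest: "\<forall>x\<in>set xs. f x < f b \<Longrightarrow> insort_key f b xs = xs @ [b]"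
  by (induction xs) auto

text \<open>Commuting insertions are what a fold over a set requires. Injectivity is demanded only
  on a carrier set because the reading order is injective only on the shape.\<close>

lemma insort_key_commute_on:
  assumes "inj_on f A" and "x \<in> A" "y \<in> A"
  shows "insort_key f y (insort_key f x xs) = insort_key f x (insort_key f y xs)"
  using assms by (induction xs) (auto dest: inj_onD)

lemma sorted_key_list_of_set_empty: "sorted_key_list_of_set f {} = []"
proof -
  interpret folding_on "{}" "insort_key f" "[]"
    by unfold_locales simp
  show ?thesis by (simp add: sorted_key_list_of_set_def)
qed

lemma sorted_key_list_of_set_insert:
  assumes "inj_on f (insert b A)" "finite A" "b \<notin> A"
  shows "sorted_key_list_of_set f (insert b A) = insort_key f b (sorted_key_list_of_set f A)"
proof -
  interpret folding_on "insert b A" "insort_key f" "[]"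
    by unfold_locales (use insort_key_commute_on[OF assms(1)] in \<open>simp add: fun_eq_iff\<close>)
  show ?thesis using assms insert[of b A] by (simp add: sorted_key_list_of_set_def)
qed

lemma set_sorted_key_list_of_set:
  assumes "inj_on f A" and "finite A"
  shows "set (sorted_key_list_of_set f A) = A"
  using assms(2,1)
proof (induction A)
  case (insert b A)
  then show ?case
    using sorted_key_list_of_set_insert[of f b A] inj_on_subset[of f "insert b A" A] by (auto simp: set_insort_key)
qed (simp add: sorted_key_list_of_set_empty)

lemma sorted_key_list_of_set_insert_greatest:
  assumes "inj_on f (insert b A)" "finite A" "\<forall>a\<in>A. f a < f b"
  shows "sorted_key_list_of_set f (insert b A) = sorted_key_list_of_set f A @ [b]"
proof -
  have "b \<notin> A" using assms(3) by blast
  with assms show ?thesis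
    by (simp add: sorted_key_list_of_set_insert set_sorted_key_list_of_set insort_key_greatest)
qed

section \<open>Ferrers shapes\<close>

locale ordered_shape =
  fixes n k :: nat and S :: "nat set" and rd :: "box \<Rightarrow> nat"
  assumes path: "lattice_path n k S"
    and order: "reading_order n S rd"
begin

abbreviation shape :: "box set" where
  "shape \<equiv> ferrers n S"

abbreviation lab :: "box \<Rightarrow> nat" where
  "lab \<equiv> box_label n k"

abbreviation souths :: "nat \<Rightarrow> nat" where
  "souths t \<equiv> fst (path_point n S t)"

abbreviation wests :: "nat \<Rightarrow> nat" where
  "wests t \<equiv> snd (path_point n S t)"

lemma S_subset: "S \<subseteq> {1..n}" and card_S: "card S = k"
  using path by (simp_all add: lattice_path_def)

lemma finite_S: "finite S"
  using S_subset finite_subset by blast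

lemma k_le_n: "k \<le> n"
  using card_mono[OF _ S_subset] card_S by simp

lemma souths_mono: "s \<le> t \<Longrightarrow> souths s \<le> souths t"
  by (auto simp: path_point_def finite_S intro!: card_mono)

lemma wests_antimono: "s \<le> t \<Longrightarrow> wests t \<le> wests s"
  by (auto simp: path_point_def intro!: card_mono)

lemma souths_0: "souths 0 = 0"
  using S_subset by (auto simp: path_point_def)

lemma wests_n: "wests n = 0"
  by (auto simp: path_point_def)

lemma souths_Suc: "souths (Suc t) = souths t + (if Suc t \<in> S then 1 else 0)"
proof -
  have "{i \<in> S. i \<le> Suc t} = (if Suc t \<in> S then insert (Suc t) {i \<in> S. i \<le> t} else {i \<in> S. i \<le> t})"
    by (auto simp: le_Suc_eq)
  then show ?thesis by (simp add: path_point_def finite_S)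
qed

lemma wests_eq: "wests t = wests (Suc t) + (if Suc t \<in> {1..n} - S then 1 else 0)"
proof -
  have "t < i \<longleftrightarrow> i = Suc t \<or> Suc t < i" for i
    by auto
  then have "{i \<in> {1..n} - S. t < i} =
      (if Suc t \<in> {1..n} - S then insert (Suc t) {i \<in> {1..n} - S. Suc t < i}
       else {i \<in> {1..n} - S. Suc t < i})"
    by auto
  then show ?thesis unfolding path_point_def by simp
qed

lemma souths_n: "souths n = k"
proof -
  have "{i \<in> S. i \<le> n} = S" using S_subset by auto
  then show ?thesis by (simp add: path_point_def card_S)
qed

text \<open>Of the first t steps, t - \<open>souths t\<close> go West, so n - k minus that number
  remain. Compared with the formula for \<open>box_label\<close>, this makes the label of a box
  whose Southeast corner lies on the path the index of that path point.\<close>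

lemma path_point_sum: "t \<le> n \<Longrightarrow> t + wests t = souths t + (n - k)"
proof (induction t rule: inc_induct)
  case base
  show ?case using k_le_n by (simp add: souths_n wests_n)
next
  case (step t)
  then have "Suc t \<in> {1..n}" by simp
  with step.IH souths_Suc[of t] wests_eq[of t] show ?case
    by (cases "Suc t \<in> S") simp_all
qed

lemma shape_iff:
  "(r, c) \<in> shape \<longleftrightarrow> 1 \<le> r \<and> 1 \<le> c \<and> (\<exists>t\<le>n. r \<le> souths t \<and> c \<le> wests t)"
  by (simp add: ferrers_def)

lemma shape_NW_closed:
  "\<lbrakk>(r, c) \<in> shape; 1 \<le> r'; r' \<le> r; 1 \<le> c'; c' \<le> c\<rbrakk> \<Longrightarrow> (r', c') \<in> shape"
  unfolding shape_iff by (meson le_trans)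

lemma shape_bounds:
  assumes "(r, c) \<in> shape"
  shows "1 \<le> r" "r \<le> k" "1 \<le> c" "c \<le> n - k"
proof -
  from assms obtain t where t: "1 \<le> r" "1 \<le> c" "t \<le> n" "r \<le> souths t" "c \<le> wests t"
    unfolding shape_iff by blast
  moreover have "wests 0 = n - k" using path_point_sum[of 0] souths_0 by simp
  ultimately show "1 \<le> r" "r \<le> k" "1 \<le> c" "c \<le> n - k"
    using souths_mono[of t n] wests_antimono[of 0 t] souths_n by simp_all
qed

lemma finite_shape: "finite shape"
  by (rule finite_subset[of _ "{..k} \<times> {..n - k}"]) (auto dest: shape_bounds)

lemma lab_range: "b \<in> shape \<Longrightarrow> lab b \<in> {1..<n}"
  using shape_bounds[of "fst b" "snd b"] k_le_n by (auto simp: box_label_def)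

lemma south_step_at_row_end:
  assumes inn: "(r, c) \<in> shape" and out: "(r, Suc c) \<notin> shape"
  shows "south_step_in_row n S r = lab (r, c)"
proof -
  from inn obtain t where t: "1 \<le> r" "1 \<le> c" "t \<le> n" "r \<le> souths t" "c \<le> wests t"
    unfolding shape_iff by blast
  \<comment> \<open>The first time at which r South steps have been made; hence step
    \<open>i\<close> itself is the South step of row r.\<close>
  define i where "i = (LEAST t. r \<le> souths t)"
  have i: "r \<le> souths i" "i \<le> t"
    unfolding i_def using t(4) by (auto intro: LeastI Least_le)
  with t(1) souths_0 obtain j where j: "i = Suc j" by (cases i) auto
  have "\<not> r \<le> souths j"
    using not_less_Least[of j "\<lambda>t. r \<le> souths t"] j i_def by auto
  with i(1) j souths_Suc[of j] have iS: "i \<in> S" and ri: "souths i = r"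
    by (auto split: if_splits)
  have "c \<le> wests i" using wests_antimono[OF i(2)] t by simp
  moreover have "\<not> Suc c \<le> wests i"
    using out t i unfolding shape_iff by (metis One_nat_def le_SucI le_trans)
  ultimately have "wests i = c" by simp
  with path_point_sum[of i] ri i(2) t(3) have "i + c = r + (n - k)" by simp
  moreover have "south_step_in_row n S r = i"
    unfolding south_step_in_row_def
  proof (rule the_equality)
    show "j = i" if "j \<in> S \<and> souths j = r" for j
    proof -
      have *: "souths a < souths b" if "b \<in> S" "a < b" for a b
        using that souths_Suc[of "b - 1"] souths_mono[of a "b - 1"] by (cases b) auto
      show ?thesis using *[of i j] *[of j i] that iS ri by (metis less_irrefl linorder_neqE_nat)
    qed
  qed (simp add: iS ri)
  ultimately show ?thesis by (simp add: box_label_def)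
qed

text \<open>The path point at the Southeast corner of the box has index \<open>lab (r, c)\<close>. A
  South step along the right side ends there, whereas the West step along the bottom starts there;
  hence the \<open>Suc\<close>.\<close>

lemma west_step_at_column_end:
  assumes inn: "(r, c) \<in> shape" and out: "(Suc r, c) \<notin> shape"
  shows "west_step_in_column n S c = Suc (lab (r, c))"
proof -
  from inn obtain t where t: "1 \<le> r" "1 \<le> c" "t \<le> n" "r \<le> souths t" "c \<le> wests t"
    unfolding shape_iff by blast
  define i where "i = (LEAST t. wests t < c)"
  have i: "wests i < c" "i \<le> n"
    unfolding i_def using t(2) wests_n by (auto intro: LeastI[of _ n] Least_le)
  have "t < i" using i(1) t(5) wests_antimono[of i t] by (meson leD le_trans not_le)
  then obtain j where j: "i = Suc j" by (cases i) auto
  have "\<not> wests j < c"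
    using not_less_Least[of j "\<lambda>t. wests t < c"] j i_def by auto
  with i(1) j wests_eq[of j] have iW: "i \<in> {1..n} - S" and cj: "wests j = c"
    by (auto split: if_splits)
  have "r \<le> souths j" using souths_mono[of t j] t \<open>t < i\<close> j by simp
  moreover have "\<not> Suc r \<le> souths j"
  proof
    assume "Suc r \<le> souths j"
    then have "(Suc r, c) \<in> shape" unfolding shape_iff using t(2) cj i(2) j
      by (intro conjI exI[of _ j]) simp_all
    with out show False ..
  qed
  ultimately have "souths j = r" by simp
  with path_point_sum[of j] cj i(2) j have "j + c = r + (n - k)" by simp
  moreover have "west_step_in_column n S c = i"
    unfolding west_step_in_column_def
  proof (rule the_equality)
    show "m = i" if m: "m \<in> {1..n} - S \<and> wests (m - 1) = c" for m
    proof -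
      have *: "wests (b - 1) < wests (a - 1)" if "a \<in> {1..n} - S" "a < b" for a b
      proof -
        have "wests (a - 1) = wests a + 1" using that wests_eq[of "a - 1"] by auto
        moreover have "a \<le> b - 1" using that by simp
        ultimately show ?thesis using wests_antimono[of a "b - 1"] by simp
      qed
      have "wests (i - 1) = c" using cj j by simp
      with *[of i m] *[of m i] m iW show ?thesis by (metis less_irrefl linorder_neqE_nat)
    qed
  qed (use iW cj j in simp)
  ultimately show ?thesis using j by (simp add: box_label_def)
qed

lemma rd_inj: "inj_on rd shape"
  using order by (auto simp: reading_order_def bij_betw_def)

lemma rd_image: "rd ` shape = {1..card shape}"
  using order by (auto simp: reading_order_def bij_betw_def)

lemma rd_range: "b \<in> shape \<Longrightarrow> rd b \<in> {1..card shape}"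
  using rd_image by blast

lemma box_before_rd_less:
  "\<lbrakk>x \<in> shape; y \<in> shape; box_before x y\<rbrakk> \<Longrightarrow> rd x < rd y"
  using order by (auto simp: reading_order_def)

section \<open>Products of stones and pipe labels\<close>

text \<open>\<open>u_in\<close> is the case of the set \<open>in_boxes n S b\<close>; the arguments
  below need the same product over other sets of boxes.\<close>

definition stone_prod :: "diagram \<Rightarrow> box set \<Rightarrow> nat \<Rightarrow> nat" where
  "stone_prod D I = word_prod (map lab (sorted_key_list_of_set rd {c \<in> I. is_stone D c}))"

lemma stone_prod_empty [simp]: "stone_prod D {} = id"
  by (simp add: stone_prod_def sorted_key_list_of_set_empty word_prod_Nil)

lemma stone_prod_insert:
  assumes I: "insert b I \<subseteq> shape" and less: "\<And>c. c \<in> I \<Longrightarrow> rd c < rd b"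
  shows "stone_prod D (insert b I) =
    (if is_stone D b then stone_prod D I \<circ> simple_transp (lab b) else stone_prod D I)"
proof (cases "is_stone D b")
  case True
  let ?A = "{c \<in> I. is_stone D c}"
  have "finite ?A"
    by (rule finite_subset[OF _ finite_shape]) (use I in auto)
  moreover have "inj_on rd (insert b ?A)"
    by (rule inj_on_subset[OF rd_inj]) (use I in auto)
  ultimately have "sorted_key_list_of_set rd (insert b ?A) = sorted_key_list_of_set rd ?A @ [b]"
    using less by (intro sorted_key_list_of_set_insert_greatest) auto
  moreover have "{c \<in> insert b I. is_stone D c} = insert b ?A" using True by auto
  ultimately show ?thesis using True by (simp add: stone_prod_def word_prod_snoc)
next
  case False
  then have "{c \<in> insert b I. is_stone D c} = {c \<in> I. is_stone D c}" by auto
  with False show ?thesis by (simp add: stone_prod_def)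
qed

lemma stone_prod_permutes:
  assumes "I \<subseteq> shape"
  shows "stone_prod D I permutes {1..n}"
proof -
  have "finite {c \<in> I. is_stone D c}"
    by (rule finite_subset[OF _ finite_shape]) (use assms in auto)
  moreover have "inj_on rd {c \<in> I. is_stone D c}"
    by (rule inj_on_subset[OF rd_inj]) (use assms in auto)
  ultimately have "set (sorted_key_list_of_set rd {c \<in> I. is_stone D c}) \<subseteq> shape"
    using assms by (subst set_sorted_key_list_of_set) auto
  then have "set (map lab (sorted_key_list_of_set rd {c \<in> I. is_stone D c})) \<subseteq> {1..<n}"
    using lab_range by (simp only: set_map image_subset_iff subset_iff) blast
  then show ?thesis
    unfolding stone_prod_def by (rule word_prod_permutes)
qed

text \<open>Order ideals for the order in which pipes visit boxes. What remains of the shape is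
  again a Ferrers shape, so the pipes entering the remainder are read off along a lattice
  path.\<close>

definition SE_closed :: "box set \<Rightarrow> bool" where
  "SE_closed I \<longleftrightarrow> I \<subseteq> shape \<and> (\<forall>x\<in>I. \<forall>y\<in>shape. box_before y x \<longrightarrow> y \<in> I)"

lemma SE_closedD: "\<lbrakk>SE_closed I; x \<in> I; y \<in> shape; box_before y x\<rbrakk> \<Longrightarrow> y \<in> I"
  by (auto simp: SE_closed_def)

lemma finite_SE_closed: "SE_closed I \<Longrightarrow> finite I"
  using finite_shape finite_subset by (auto simp: SE_closed_def)

lemma SE_closed_insertD:
  assumes closed: "SE_closed (insert b I)" and less: "\<And>c. c \<in> I \<Longrightarrow> rd c < rd b"
  shows "SE_closed I"
  unfolding SE_closed_def
proof (intro conjI ballI impI)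
  show sub: "I \<subseteq> shape" using closed by (simp add: SE_closed_def)
  fix x y assume xy: "x \<in> I" "y \<in> shape" "box_before y x"
  then have "rd y < rd b" using sub less[of x] box_before_rd_less[of y x] by auto
  moreover have "y \<in> insert b I" using SE_closedD[OF closed _ xy(2,3)] xy(1) by simp
  ultimately show "y \<in> I" by auto
qed

lemma lab_left: "(r, Suc c) \<in> shape \<Longrightarrow> lab (r, c) = Suc (lab (r, Suc c))"
  using shape_bounds[of r "Suc c"] by (simp add: box_label_def)

lemma lab_above: "(Suc r, c) \<in> shape \<Longrightarrow> lab (Suc r, c) = Suc (lab (r, c))"
  using shape_bounds[of "Suc r" c] by (simp add: box_label_def)

lemma lab_add_column: "(r, c) \<in> shape \<Longrightarrow> lab (r, c) + c = (n - k) + r"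
  using shape_bounds[of r c] by (simp add: box_label_def)

text \<open>The right side of (r, c) is a step of the boundary of \<open>I\<close>;
  \<open>column_ready\<close> says this of the bottom side. The two are kept apart because a
  boundary step may border a box whose other neighbour is still missing.\<close>

definition row_ready :: "box set \<Rightarrow> nat \<Rightarrow> nat \<Rightarrow> bool" where
  "row_ready I r c \<longleftrightarrow> (r, c) \<in> shape - I \<and> ((r, Suc c) \<in> shape \<longrightarrow> (r, Suc c) \<in> I)"

definition column_ready :: "box set \<Rightarrow> nat \<Rightarrow> nat \<Rightarrow> bool" where
  "column_ready I r c \<longleftrightarrow> (r, c) \<in> shape - I \<and> ((Suc r, c) \<in> shape \<longrightarrow> (Suc r, c) \<in> I)"

text \<open>Labels are constant on diagonals. A ready step other than those next to the new box
  could therefore share a label with it only if its box lay strictly Northwest or weakly Southeast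
  of the new one. In the first case a neighbour in \<open>I\<close> would force the new box into
  \<open>I\<close>; in the second, closure after the insertion would already contain (r, c).\<close>

lemma not_in_interior:
  assumes I: "SE_closed I" "SE_closed (insert (rb, cb) I)" "(rb, cb) \<notin> I"
    and rc: "(r, c) \<in> shape" "(r, c) \<notin> insert (rb, cb) I"
  shows "row_ready I r c \<Longrightarrow> \<not> (r < rb \<and> c < cb)"
    and "column_ready I r c \<Longrightarrow> \<not> (r < rb \<and> c < cb)"
    and "\<not> (rb \<le> r \<and> cb \<le> c)"
proof -
  have b: "(rb, cb) \<in> shape" using I(2) by (simp add: SE_closed_def)
  show "\<not> (r < rb \<and> c < cb)" if "row_ready I r c"
  proof
    assume less: "r < rb \<and> c < cb"
    then have "(r, Suc c) \<in> shape"
      using shape_NW_closed[OF b, of r "Suc c"] shape_bounds[OF rc(1)] by auto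
    with that have "(r, Suc c) \<in> I" by (simp add: row_ready_def)
    moreover have "box_before (rb, cb) (r, Suc c)" using less by (auto simp: box_before_def)
    ultimately show False using SE_closedD[OF I(1)] b I(3) by blast
  qed
  show "\<not> (r < rb \<and> c < cb)" if "column_ready I r c"
  proof
    assume less: "r < rb \<and> c < cb"
    then have "(Suc r, c) \<in> shape"
      using shape_NW_closed[OF b, of "Suc r" c] shape_bounds[OF rc(1)] by auto
    with that have "(Suc r, c) \<in> I" by (simp add: column_ready_def)
    moreover have "box_before (rb, cb) (Suc r, c)" using less by (auto simp: box_before_def)
    ultimately show False using SE_closedD[OF I(1)] b I(3) by blast
  qed
  show "\<not> (rb \<le> r \<and> cb \<le> c)"
  proof
    assume "rb \<le> r \<and> cb \<le> c"
    then have "box_before (r, c) (rb, cb)" using rc(2) by (auto simp: box_before_def)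
    with SE_closedD[OF I(2) insertI1 rc(1)] rc(2) show False by blast
  qed
qed

text \<open>
  The Northwest boundary of an SE-closed set of boxes is again a lattice path with n steps. Its
  step i carries the pipe with label \<open>stone_prod D I i\<close>; a box with label i that is added
  next meets the steps i (on its right) and i + 1 (below it).
\<close>

lemma stone_prod_eq_pipes:
  assumes "SE_closed I"
  shows "(\<forall>r c. row_ready I r c \<longrightarrow> stone_prod D I (lab (r, c)) = pipe_from_right n S D r c) \<and>
    (\<forall>r c. column_ready I r c \<longrightarrow> stone_prod D I (Suc (lab (r, c))) = pipe_from_below n S D r c)"
  using finite_SE_closed[OF assms] assms
\<comment> \<open>Boxes enter in increasing reading order, so each new stone is the rightmost
  factor. The rule gives only a weak inequality; injectivity of \<open>rd\<close> makes it
  strict.\<close>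
proof (induction I rule: finite_ranking_induct[where f = rd])
  case empty
  have "pipe_from_right n S D r c = lab (r, c)" if "row_ready {} r c" for r c
    using that south_step_at_row_end[of r c]
    by (subst pipe_from_right.simps) (simp add: row_ready_def)
  moreover have "pipe_from_below n S D r c = Suc (lab (r, c))" if "column_ready {} r c" for r c
    using that west_step_at_column_end[of r c]
    by (subst pipe_from_below.simps) (simp add: column_ready_def)
  ultimately show ?case by simp
next
  case (insert b I)
  show ?case
  proof (cases "b \<in> I")
    case True
    with insert show ?thesis by (simp add: insert_absorb)
  next
    case False
    obtain rb cb where b: "b = (rb, cb)" by force
    have sub: "insert b I \<subseteq> shape" using insert.prems by (simp add: SE_closed_def)
    have less: "rd c < rd b" if "c \<in> I" for c
    proof -
      have "rd c \<noteq> rd b" using rd_inj sub that False by (auto dest: inj_onD)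
      with insert.hyps(2)[OF that] show ?thesis by simp
    qed
    have closed: "SE_closed I" by (rule SE_closed_insertD[OF insert.prems less])
    note IH = insert.IH[OF closed]
    let ?v = "stone_prod D I" and ?v' = "stone_prod D (insert b I)"
    have v': "?v' = (if is_stone D b then ?v \<circ> simple_transp (lab b) else ?v)"
      by (rule stone_prod_insert[OF sub less])
    have bshape: "(rb, cb) \<in> shape" using sub b by simp
    have next_in: "x \<in> I" if "x \<in> shape" "box_before x b" for x
      using SE_closedD[OF insert.prems insertI1 that] that(2) by (auto simp: box_before_def)
    have "row_ready I rb cb" "column_ready I rb cb"
      unfolding row_ready_def column_ready_def
      using bshape False b by (auto intro!: next_in simp: box_before_def)
    with IH have vb: "?v (lab b) = pipe_from_right n S D rb cb"
      "?v (Suc (lab b)) = pipe_from_below n S D rb cb"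
      by (simp_all add: b)
    note no = not_in_interior[OF closed insert.prems[unfolded b] False[unfolded b]]
    have lb: "lab b + cb = (n - k) + rb" using lab_add_column[OF bshape] b by simp
    show ?thesis
    proof (intro conjI allI impI)
      fix r c assume ready: "row_ready (insert b I) r c"
      then have rc: "(r, c) \<in> shape" "(r, c) \<notin> insert (rb, cb) I"
        by (auto simp: row_ready_def b)
      have lrc: "lab (r, c) + c = (n - k) + r" by (rule lab_add_column[OF rc(1)])
      show "?v' (lab (r, c)) = pipe_from_right n S D r c"
      \<comment> \<open>The step right of (r, c) now carries the pipe leaving \<open>b\<close> to
        the left, and its index is \<open>Suc (lab b)\<close>. A stone moves the pipe from the right
        of \<open>b\<close> to this index; a plus leaves the pipe from below there.\<close>
      proof (cases "(r, Suc c) = b")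
        case True
        then show ?thesis
          unfolding v' using bshape vb lab_left[of r c] pipe_from_right.simps[of n S D r c] b
          by (auto simp: simple_transp_simps)
      next
        case False
        with ready have "row_ready I r c" by (auto simp: row_ready_def)
        moreover from no(1)[OF rc this] no(3)[OF rc] False
        have "lab (r, c) \<noteq> lab b" "lab (r, c) \<noteq> Suc (lab b)"
          using lb lrc b by (auto simp: not_less not_le)
        ultimately show ?thesis
          using IH by (auto simp: v' simple_transp_simps)
      qed
    next
      fix r c assume ready: "column_ready (insert b I) r c"
      then have rc: "(r, c) \<in> shape" "(r, c) \<notin> insert (rb, cb) I"
        by (auto simp: column_ready_def b)
      have lrc: "lab (r, c) + c = (n - k) + r" by (rule lab_add_column[OF rc(1)])
      show "?v' (Suc (lab (r, c))) = pipe_from_below n S D r c"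
      proof (cases "(Suc r, c) = b")
        case True
        then show ?thesis
          unfolding v' using bshape vb lab_above[of r c] pipe_from_below.simps[of n S D r c] b
          by (auto simp: simple_transp_simps)
      next
        case False
        with ready have "column_ready I r c" by (auto simp: column_ready_def)
        moreover from no(2)[OF rc this] no(3)[OF rc] False
        have "Suc (lab (r, c)) \<noteq> lab b" "Suc (lab (r, c)) \<noteq> Suc (lab b)"
          using lb lrc b by (auto simp: not_less not_le)
        ultimately show ?thesis
          using IH by (auto simp: v' simple_transp_simps)
      qed
    qed
  qed
qed

section \<open>The length condition and the order of boxes along a pipe\<close>

abbreviation right_pipe :: "diagram \<Rightarrow> box \<Rightarrow> nat" where
  "right_pipe D b \<equiv> pipe_from_right n S D (fst b) (snd b)"

abbreviation below_pipe :: "diagram \<Rightarrow> box \<Rightarrow> nat" where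
  "below_pipe D b \<equiv> pipe_from_below n S D (fst b) (snd b)"

lemma stone_prod_at_box:
  assumes "SE_closed I" "b \<in> shape" "b \<notin> I" "\<And>c. c \<in> shape \<Longrightarrow> box_before c b \<Longrightarrow> c \<in> I"
  shows "stone_prod D I (lab b) = right_pipe D b"
    and "stone_prod D I (Suc (lab b)) = below_pipe D b"
proof -
  have "row_ready I (fst b) (snd b)" "column_ready I (fst b) (snd b)"
    using assms(2,3) assms(4)[of "(fst b, Suc (snd b))"] assms(4)[of "(Suc (fst b), snd b)"]
    by (auto simp: row_ready_def column_ready_def box_before_def prod_eq_iff)
  with stone_prod_eq_pipes[OF assms(1), of D]
  have "stone_prod D I (lab b) = right_pipe D b \<and> stone_prod D I (Suc (lab b)) = below_pipe D b"
    by (metis prod.collapse)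
  then show "stone_prod D I (lab b) = right_pipe D b"
    and "stone_prod D I (Suc (lab b)) = below_pipe D b"
    by simp_all
qed

definition prior :: "box \<Rightarrow> box set" where
  "prior b = {c \<in> shape. box_before c b}"

lemma box_before_trans: "box_before x y \<Longrightarrow> box_before y z \<Longrightarrow> box_before x z"
  by (auto simp: box_before_def prod_eq_iff)

lemma SE_closed_prior: "SE_closed (prior b)"
  by (auto simp: SE_closed_def prior_def intro: box_before_trans)

lemma SE_closed_Un: "SE_closed I \<Longrightarrow> SE_closed J \<Longrightarrow> SE_closed (I \<union> J)"
  by (auto simp: SE_closed_def)

lemma not_in_prior: "b \<notin> prior b"
  by (simp add: prior_def box_before_def)

text \<open>If \<open>b\<close> has a stone, its factor ends \<open>u_in\<close> and is cancelled by
  \<open>u_box\<close>; otherwise neither is present. In both cases the condition asks for a descent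
  at \<open>lab b\<close> of the product over \<open>prior b\<close>, whose values there are the two
  entering pipes.\<close>

lemma length_drops_iff:
  assumes "b \<in> shape"
  shows "length_drops n k S rd D b \<longleftrightarrow> below_pipe D b < right_pipe D b"
proof -
  let ?v = "stone_prod D (prior b)"
  have "in_boxes n S b = insert b (prior b)"
    using assms by (auto simp: in_boxes_def prior_def box_before_def)
  then have "u_in n k S rd D b = stone_prod D (insert b (prior b))"
    by (simp add: u_in_def stone_prod_def)
  also have "\<dots> = (if is_stone D b then ?v \<circ> simple_transp (lab b) else ?v)"
    using assms by (intro stone_prod_insert) (auto simp: prior_def box_before_rd_less)
  finally have "u_in n k S rd D b \<circ> u_box n k D b = ?v"
    by (simp add: u_box_def comp_simple_transp_twice)
  moreover have "?v permutes {1..n}"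
    by (rule stone_prod_permutes) (auto simp: prior_def)
  ultimately have "length_drops n k S rd D b \<longleftrightarrow> ?v (Suc (lab b)) < ?v (lab b)"
    unfolding length_drops_def using coxeter_length_drops_iff lab_range[OF assms] by metis
  moreover have "?v (lab b) = right_pipe D b" "?v (Suc (lab b)) = below_pipe D b"
    by (rule stone_prod_at_box[OF SE_closed_prior assms not_in_prior]; simp add: prior_def)+
  ultimately show ?thesis by simp
qed

lemma inj_stone_prod: "I \<subseteq> shape \<Longrightarrow> inj (stone_prod D I)"
  by (rule permutes_inj[OF stone_prod_permutes])

text \<open>Two incomparable boxes can both be added next to the union of their \<open>prior\<close>
  sets. Their labels differ by at least 2, so they touch disjoint pairs of boundary steps, and
  injectivity of the product separates their pipes.\<close>

lemma boxes_on_common_pipe_comparable: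
  assumes x: "x \<in> shape" and y: "y \<in> shape" and "x \<noteq> y"
    and common: "pipes_at n S D x \<inter> pipes_at n S D y \<noteq> {}"
  shows "box_before x y \<or> box_before y x"
proof (rule ccontr)
  assume incomp: "\<not> ?thesis"
  let ?I = "prior x \<union> prior y"
  let ?v = "stone_prod D ?I"
  have closed: "SE_closed ?I" by (intro SE_closed_Un SE_closed_prior)
  have notin: "x \<notin> ?I" "y \<notin> ?I" using incomp not_in_prior by (auto simp: prior_def)
  have "?v (lab x) = right_pipe D x" "?v (Suc (lab x)) = below_pipe D x"
    by (rule stone_prod_at_box[OF closed x notin(1)]; simp add: prior_def)+
  moreover have "?v (lab y) = right_pipe D y" "?v (Suc (lab y)) = below_pipe D y"
    by (rule stone_prod_at_box[OF closed y notin(2)]; simp add: prior_def)+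
  ultimately have "pipes_at n S D x = ?v ` {lab x, Suc (lab x)}" "pipes_at n S D y = ?v ` {lab y, Suc (lab y)}"
    by (simp_all add: pipes_at_def)
  moreover have "inj ?v"
    by (rule inj_stone_prod) (auto simp: prior_def)
  moreover have "{lab x, Suc (lab x)} \<inter> {lab y, Suc (lab y)} = {}"
  proof -
    have "lab x + snd x = (n - k) + fst x" "lab y + snd y = (n - k) + fst y"
      using lab_add_column[of "fst x" "snd x"] lab_add_column[of "fst y" "snd y"] x y by simp_all
    moreover have "fst x < fst y \<and> snd y < snd x \<or> fst y < fst x \<and> snd x < snd y"
      using incomp \<open>x \<noteq> y\<close> by (auto simp: box_before_def not_le prod_eq_iff)
    ultimately show ?thesis by auto
  qed
  ultimately show False using common by (metis image_Int image_empty)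
qed

section \<open>Products along initial segments of the reading order\<close>

definition segment :: "nat \<Rightarrow> box set" where
  "segment j = {c \<in> shape. rd c \<le> j}"

definition partial_prod :: "diagram \<Rightarrow> nat \<Rightarrow> nat \<Rightarrow> nat" where
  "partial_prod D j = stone_prod D (segment j)"

lemma SE_closed_segment: "SE_closed (segment j)"
  unfolding SE_closed_def
proof (intro conjI ballI impI)
  fix x y assume "x \<in> segment j" "y \<in> shape" "box_before y x"
  with box_before_rd_less[of y x] show "y \<in> segment j" by (simp add: segment_def)
qed (auto simp: segment_def)

lemma partial_prod_0: "partial_prod D 0 = id"
proof -
  have "b \<notin> segment 0" for b using rd_range[of b] by (auto simp: segment_def)
  then have "segment 0 = {}" by blast
  then show ?thesis by (simp add: partial_prod_def)
qed

lemma partial_prod_permutes: "partial_prod D j permutes {1..n}"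
  unfolding partial_prod_def by (rule stone_prod_permutes) (auto simp: segment_def)

lemma partial_prod_Suc:
  assumes "b \<in> shape" "rd b = Suc j"
  shows "partial_prod D (Suc j) =
    (if is_stone D b then partial_prod D j \<circ> simple_transp (lab b) else partial_prod D j)"
proof -
  have "c \<in> segment (Suc j) \<longleftrightarrow> c \<in> insert b (segment j)" for c
    using inj_onD[OF rd_inj, of c b] assms by (auto simp: segment_def le_Suc_eq)
  then have "segment (Suc j) = insert b (segment j)" by blast
  then show ?thesis
    unfolding partial_prod_def using assms stone_prod_insert[of b "segment j" D]
    by (simp add: segment_def)
qed

lemma partial_prod_at_box:
  assumes "b \<in> shape" "rd b = Suc j"
  shows "partial_prod D j (lab b) = right_pipe D b"
    and "partial_prod D j (Suc (lab b)) = below_pipe D b"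
proof -
  have "c \<in> segment j" if "c \<in> shape" "box_before c b" for c
    using box_before_rd_less[OF that(1) assms(1) that(2)] that(1) assms(2)
    by (simp add: segment_def)
  moreover have "b \<notin> segment j" using assms by (simp add: segment_def)
  ultimately show "partial_prod D j (lab b) = right_pipe D b"
    and "partial_prod D j (Suc (lab b)) = below_pipe D b"
    unfolding partial_prod_def
    by (simp_all add: stone_prod_at_box[OF SE_closed_segment assms(1)])
qed

lemma right_pipe_neq_below_pipe:
  assumes "b \<in> shape"
  shows "right_pipe D b \<noteq> below_pipe D b"
proof -
  obtain j where j: "rd b = Suc j" using rd_range[OF assms] by (cases "rd b") auto
  show ?thesis
    using partial_prod_at_box[OF assms j, of D] permutes_inj[OF partial_prod_permutes[of D j]]
    by (metis inj_eq n_not_Suc_n)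
qed

section \<open>Crossings and inverted pairs of pipes\<close>

lemma bij_partial_prod: "bij (partial_prod D j)"
  by (rule permutes_bij[OF partial_prod_permutes])

lemma partial_prod_cong:
  assumes "\<And>b. b \<in> shape \<Longrightarrow> rd b \<le> j \<Longrightarrow> is_stone D b \<longleftrightarrow> is_stone D' b"
  shows "partial_prod D j = partial_prod D' j"
proof -
  have "{c \<in> segment j. is_stone D c} = {c \<in> segment j. is_stone D' c}"
    using assms by (auto simp: segment_def)
  then show ?thesis by (simp add: partial_prod_def stone_prod_def)
qed

lemma box_at_step:
  assumes "j < card shape"
  obtains b where "b \<in> shape" "rd b = Suc j"
proof -
  have "Suc j \<in> rd ` shape" using assms unfolding rd_image by simp
  with that show ?thesis by auto
qed

lemma pred_rd:
  assumes "b \<in> shape"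
  obtains j where "rd b = Suc j" "j < card shape"
  using rd_range[OF assms] that[of "rd b - 1"] by auto

text \<open>Discrete intermediate value argument: some single box changes the order of p and q, and
  only a stone entered by exactly these two pipes can do so. When p < q, that stone is a crossing;
  in \<open>stops_inverted_between\<close> it is an uncrossing.\<close>

lemma becomes_inverted_between:
  assumes "m \<le> j" "j \<le> card shape" and "p \<noteq> q"
    and "\<not> inverted (partial_prod D m) p q" "inverted (partial_prod D j) p q"
  obtains b where "b \<in> shape" "m < rd b" "rd b \<le> j" "is_stone D b"
    "right_pipe D b = p" "below_pipe D b = q"
proof -
  have "\<exists>b\<in>shape. m < rd b \<and> rd b \<le> j \<and> is_stone D b \<and> right_pipe D b = p \<and> below_pipe D b = q"
    using assms(1,2,5)
  proof (induction j rule: dec_induct)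
    case base
    with assms(4) show ?case by simp
  next
    case (step j)
    show ?case
    proof (cases "inverted (partial_prod D j) p q")
      case True
      with step show ?thesis by fastforce
    next
      case False
      from step.prems obtain b where b: "b \<in> shape" "rd b = Suc j"
        using box_at_step[of j] by auto
      with step.prems(2) False have stone: "is_stone D b"
        and "inverted (partial_prod D j \<circ> simple_transp (lab b)) p q"
        using partial_prod_Suc[OF b, of D] by (auto split: if_splits)
      from becomes_inverted[OF bij_partial_prod \<open>p \<noteq> q\<close> this(2) False]
      have "right_pipe D b = p" "below_pipe D b = q"
        by (simp_all add: partial_prod_at_box[OF b])
      with b stone step.hyps show ?thesis by (intro bexI[of _ b]) simp_all
    qed
  qed
  with that show ?thesis by blast
qed

lemma stops_inverted_between:
  assumes "m \<le> j" "j \<le> card shape"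
    and "inverted (partial_prod D m) p q" "\<not> inverted (partial_prod D j) p q"
  obtains b where "b \<in> shape" "m < rd b" "rd b \<le> j" "is_stone D b"
    "right_pipe D b = q" "below_pipe D b = p"
proof -
  have "\<exists>b\<in>shape. m < rd b \<and> rd b \<le> j \<and> is_stone D b \<and> right_pipe D b = q \<and> below_pipe D b = p"
    using assms(1,2,4)
  proof (induction j rule: dec_induct)
    case base
    with assms(3) show ?case by simp
  next
    case (step j)
    show ?case
    proof (cases "inverted (partial_prod D j) p q")
      case False
      with step show ?thesis by fastforce
    next
      case True
      from step.prems obtain b where b: "b \<in> shape" "rd b = Suc j"
        using box_at_step[of j] by auto
      with step.prems(2) True have stone: "is_stone D b"
        and "\<not> inverted (partial_prod D j \<circ> simple_transp (lab b)) p q"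
        using partial_prod_Suc[OF b, of D] by (auto split: if_splits)
      from stops_inverted[OF bij_partial_prod True this(2)]
      have "right_pipe D b = q" "below_pipe D b = p"
        by (simp_all add: partial_prod_at_box[OF b])
      with b stone step.hyps show ?thesis by (intro bexI[of _ b]) simp_all
    qed
  qed
  with that show ?thesis by blast
qed

text \<open>The boundary is numbered from the Northeast, so just before a box is read, its pipe from
  the right stands directly before its pipe from below.\<close>

lemma inverted_at_box:
  assumes "b \<in> shape" "rd b = Suc j"
  shows "inverted (partial_prod D j) (below_pipe D b) (right_pipe D b)"
proof -
  have "inv (partial_prod D j) (right_pipe D b) = lab b"
    "inv (partial_prod D j) (below_pipe D b) = Suc (lab b)"
    by (simp_all flip: partial_prod_at_box[OF assms] add: bij_is_inj[OF bij_partial_prod])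
  then show ?thesis by (simp add: inverted_def)
qed

lemma not_inverted_at_box:
  assumes "b \<in> shape" "rd b = Suc j"
  shows "\<not> inverted (partial_prod D j) (right_pipe D b) (below_pipe D b)"
  using inverted_at_box[OF assms, of D] by (simp add: inverted_def)

text \<open>Thus first and last along two pipes can be decided by comparing values of
  \<open>rd\<close>.\<close>

lemma same_pipes_box_before:
  assumes "x \<in> shape" "y \<in> shape" "rd x < rd y" "pipes_at n S D x = pipes_at n S D y"
  shows "box_before x y"
proof -
  have "x \<noteq> y" "pipes_at n S D x \<inter> pipes_at n S D y \<noteq> {}"
    using assms by (auto simp: pipes_at_def)
  with boxes_on_common_pipe_comparable[OF assms(1,2)] have "box_before x y \<or> box_before y x"
    by blast
  then show ?thesis using box_before_rd_less[of y x] assms by auto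
qed

lemma last_crossing_exists:
  assumes b: "b \<in> shape" and viol: "below_pipe D b < right_pipe D b"
  shows "\<exists>c. last_crossing n S D b c"
proof -
  obtain j where j: "rd b = Suc j" "j < card shape" using pred_rd[OF b] .
  let ?C = "{c. box_before c b \<and> is_crossing n S D c \<and> pipes_at n S D c = pipes_at n S D b}"
  have C: "c \<in> shape" if "c \<in> ?C" for c using that by (simp add: is_crossing_def)
  \<comment> \<open>The empty product is the identity, in which the pair is in order; some stone
    before \<open>b\<close> must have inverted it.\<close>
  have "0 \<le> j" "j \<le> card shape" "below_pipe D b \<noteq> right_pipe D b"
    "\<not> inverted (partial_prod D 0) (below_pipe D b) (right_pipe D b)"
    using j viol by (simp_all add: inverted_def partial_prod_0)
  from becomes_inverted_between[OF this inverted_at_box[OF b j(1)]]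
  obtain e where e: "e \<in> shape" "0 < rd e" "rd e \<le> j" "is_stone D e"
    "right_pipe D e = below_pipe D b" "below_pipe D e = right_pipe D b" .
  have "pipes_at n S D e = pipes_at n S D b" using e by (auto simp: pipes_at_def)
  with e b j viol have "e \<in> ?C"
    using same_pipes_box_before[of e b D] by (simp add: is_crossing_def)
  moreover have "finite ?C" by (rule finite_subset[OF _ finite_shape]) (use C in blast)
  ultimately obtain c where c: "c \<in> ?C" "\<forall>c'\<in>?C. rd c' \<le> rd c"
    using Max_in[of "rd ` ?C"] Max_ge[of "rd ` ?C"] by (smt (verit) empty_iff finite_imageI imageE imageI)
  have "c' = c \<or> box_before c' c" if "c' \<in> ?C" for c'
  proof (cases "rd c' = rd c")
    case True
    then show ?thesis using inj_onD[OF rd_inj True] C that c(1) by blast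
  next
    case False
    with c that have "rd c' < rd c" by (meson le_neq_implies_less)
    then show ?thesis using same_pipes_box_before[of c' c D] C that c(1) by simp
  qed
  with c(1) have "last_crossing n S D b c" unfolding last_crossing_def by blast
  then show ?thesis ..
qed

section \<open>The potential\<close>

text \<open>It depends on the positions of the stones but not on their colors, so recoloring leaves
  it unchanged.\<close>

definition potential :: "diagram \<Rightarrow> nat" where
  "potential D = (\<Sum>j\<le>card shape. \<Sum>i\<in>{1..n}. i * partial_prod D j i)"

lemma potential_bounded: "potential D \<le> (\<Sum>j\<le>card shape. \<Sum>i\<in>{1..n}. i * n)"
  unfolding potential_def
proof (intro sum_mono mult_le_mono2)
  fix j i assume "i \<in> {1..n}"
  then show "partial_prod D j i \<le> n"
    using permutes_in_image[OF partial_prod_permutes, of D j i] by simp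
qed

text \<open>At \<open>x\<close> exactly one of the two diagrams has a stone, which amounts to a left
  factor (p q). Common right factors preserve it, and at \<open>y\<close> the opposite discrepancy
  produces the same left factor again and cancels it.\<close>

lemma partial_prod_exchange:
  assumes x: "x \<in> shape" and y: "y \<in> shape" and less: "rd x < rd y"
    and px: "pipes_at n S D x = {p, q}" and py: "pipes_at n S D y = {p, q}"
    and D': "\<forall>b\<in>shape. is_stone D' b \<longleftrightarrow>
      (if b = x then is_stone D y else if b = y then is_stone D x else is_stone D b)"
    and neq: "is_stone D x \<noteq> is_stone D y"
  shows "j < rd x \<Longrightarrow> partial_prod D' j = partial_prod D j"
    and "rd x \<le> j \<Longrightarrow> j < rd y \<Longrightarrow> partial_prod D' j = transpose p q \<circ> partial_prod D j"
    and "rd y \<le> j \<Longrightarrow> j \<le> card shape \<Longrightarrow> partial_prod D' j = partial_prod D j"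
proof -
  let ?t = "transpose p q"
  have t: "?t \<circ> partial_prod D i = partial_prod D i \<circ> simple_transp (lab b)"
    if "b \<in> shape" "rd b = Suc i" "pipes_at n S D b = {p, q}" for b i
  proof -
    have "?t = transpose (right_pipe D b) (below_pipe D b)"
      using that(3) by (auto simp: pipes_at_def doubleton_eq_iff transpose_commute)
    then show ?thesis
      using transpose_comp_eq_comp_simple_transp[OF bij_is_inj[OF bij_partial_prod], of D i "lab b"]
      by (simp only: partial_prod_at_box[OF that(1,2)])
  qed
  have tt: "?t \<circ> (?t \<circ> w) = w" for w :: "nat \<Rightarrow> nat"
    by (simp add: fun_eq_iff)
  show before: "partial_prod D' j = partial_prod D j" if "j < rd x" for j
    using that less by (intro partial_prod_cong) (auto simp: D')
  have same: "is_stone D' b \<longleftrightarrow> is_stone D b" if "b \<in> shape" "rd b \<noteq> rd x" "rd b \<noteq> rd y" for b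
    using that D' by auto
  show between: "partial_prod D' j = ?t \<circ> partial_prod D j" if "rd x \<le> j" "j < rd y" for j
    using that
  proof (induction j rule: dec_induct)
    case base
    obtain i where i: "rd x = Suc i" using pred_rd[OF x] .
    with before[of i] t[OF x i px] tt[of "partial_prod D i"] neq bspec[OF D' x]
    show "partial_prod D' (rd x) = ?t \<circ> partial_prod D (rd x)"
      unfolding i partial_prod_Suc[OF x i] by auto
  next
    case (step j)
    then obtain b where b: "b \<in> shape" "rd b = Suc j"
      using box_at_step[of j] rd_range[OF y] by auto
    have "is_stone D' b \<longleftrightarrow> is_stone D b" using same[OF b(1)] b step by simp
    moreover have "partial_prod D' j = ?t \<circ> partial_prod D j"
      by (rule step.IH) (use step in simp_all)
    ultimately show "partial_prod D' (Suc j) = ?t \<circ> partial_prod D (Suc j)"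
      unfolding partial_prod_Suc[OF b] by (simp add: comp_assoc)
  qed
  show "partial_prod D' j = partial_prod D j" if "rd y \<le> j" "j \<le> card shape"
    using that
  proof (induction j rule: dec_induct)
    case base
    obtain i where i: "rd y = Suc i" using pred_rd[OF y] .
    have "partial_prod D' i = ?t \<circ> partial_prod D i" using between[of i] i less by simp
    moreover have "is_stone D' y \<longleftrightarrow> is_stone D x" using bspec[OF D' y] less by auto
    ultimately show "partial_prod D' (rd y) = partial_prod D (rd y)"
      unfolding i partial_prod_Suc[OF y i] using t[OF y i py] tt[of "partial_prod D i"] neq
      by (auto simp: comp_simple_transp_twice)
  next
    case (step j)
    then obtain b where b: "b \<in> shape" "rd b = Suc j"
      using box_at_step[of j] by auto
    have "is_stone D' b \<longleftrightarrow> is_stone D b" using same[OF b(1)] b step less by simp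
    with step show "partial_prod D' (Suc j) = partial_prod D (Suc j)"
      unfolding partial_prod_Suc[OF b] by simp
  qed
qed

lemma potential_exchange_less:
  assumes x: "x \<in> shape" and y: "y \<in> shape" and less: "rd x < rd y"
    and pq: "p < q" and px: "pipes_at n S D x = {p, q}" and py: "pipes_at n S D y = {p, q}"
    and D': "\<forall>b\<in>shape. is_stone D' b \<longleftrightarrow>
      (if b = x then is_stone D y else if b = y then is_stone D x else is_stone D b)"
    and neq: "is_stone D x \<noteq> is_stone D y"
    and inverted: "\<And>j. rd x \<le> j \<Longrightarrow> j < rd y \<Longrightarrow> inverted (partial_prod D j) p q"
  shows "potential D < potential D'"
proof -
  note ex = partial_prod_exchange[OF x y less px py D' neq]
  let ?f = "\<lambda>D j. \<Sum>i\<in>{1..n}. i * partial_prod D j i"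
  obtain i where i: "rd x = Suc i" using pred_rd[OF x] .
  have "{p, q} = partial_prod D i ` {lab x, Suc (lab x)}"
    using px by (simp add: pipes_at_def partial_prod_at_box[OF x i])
  also have "\<dots> \<subseteq> partial_prod D i ` {1..n}"
    using lab_range[OF x] by (intro image_mono) auto
  finally have "{p, q} \<subseteq> {1..n}"
    by (simp only: permutes_image[OF partial_prod_permutes])
  then have "p \<in> {1..n}" "q \<in> {1..n}" by simp_all
  then have strict: "?f D j < ?f D' j" if "rd x \<le> j" "j < rd y" for j
    using weighted_sum_less_transpose[OF partial_prod_permutes pq _ _ inverted[OF that]]
    by (simp only: ex(2)[OF that])
  have weak: "?f D j \<le> ?f D' j" if "j \<le> card shape" for j
  proof -
    consider "j < rd x" | "rd x \<le> j" "j < rd y" | "rd y \<le> j" by linarith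
    then show ?thesis
    proof cases
      case 1
      show ?thesis by (simp only: ex(1)[OF 1] order_refl)
    next
      case 2
      then show ?thesis using strict less_imp_le by blast
    next
      case 3
      show ?thesis by (simp only: ex(3)[OF 3 that] order_refl)
    qed
  qed
  show ?thesis
    unfolding potential_def
  proof (rule sum_strict_mono_ex1)
    show "\<exists>j\<in>{..card shape}. ?f D j < ?f D' j"
      using strict[of "rd x"] less rd_range[OF x] by auto
  qed (use weak in auto)
qed

section \<open>Corrective flips increase the potential\<close>

lemma is_stone_recolor [simp]: "is_stone (recolor n S D) b \<longleftrightarrow> is_stone D b"
  by (simp add: is_stone_def recolor_def)

lemma is_stone_exchange:
  "is_stone (D(b := D x, x := D b)) a \<longleftrightarrow>
    (if a = x then is_stone D b else if a = b then is_stone D x else is_stone D a)"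
  by (simp add: is_stone_def)

text \<open>If the pair were in order at some point after \<open>c\<close>, it would have to become
  inverted again before \<open>b\<close>, giving a crossing later than the last one.\<close>

lemma inverted_since_last_crossing:
  assumes b: "b \<in> shape" and viol: "below_pipe D b < right_pipe D b"
    and c: "last_crossing n S D b c" and j: "rd c \<le> j" "j < rd b"
  shows "inverted (partial_prod D j) (below_pipe D b) (right_pipe D b)"
proof (rule ccontr)
  let ?p = "below_pipe D b" and ?q = "right_pipe D b"
  assume not: "\<not> ?thesis"
  obtain i where i: "rd b = Suc i" "i < card shape" using pred_rd[OF b] .
  have "j \<le> i" "i \<le> card shape" "?p \<noteq> ?q" using i j viol by auto
  from becomes_inverted_between[OF this not inverted_at_box[OF b i(1)]]
  obtain e where e: "e \<in> shape" "j < rd e" "rd e \<le> i" "is_stone D e"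
    "right_pipe D e = ?p" "below_pipe D e = ?q" .
  have pe: "pipes_at n S D e = pipes_at n S D b" using e by (auto simp: pipes_at_def)
  have "box_before e b" using same_pipes_box_before[OF e(1) b _ pe] e(3) i by simp
  moreover have "is_crossing n S D e" using e viol by (simp add: is_crossing_def)
  ultimately have "e = c \<or> box_before e c" using c pe unfolding last_crossing_def by blast
  moreover have "c \<in> shape" using c by (simp add: last_crossing_def is_crossing_def)
  ultimately have "rd e \<le> rd c" using box_before_rd_less[OF e(1), of c] by auto
  with e(2) j(1) show False by simp
qed

lemma potential_corrective_flip:
  assumes "corrective_flip n k S rd D D'"
  shows "potential D < potential D'"
proof -
  from assms obtain b c x where plus: "D b = Plus"
    and viol: "violates_distinguished n k S rd D b"
    and last: "last_crossing n S D b c"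
    and x: "x = c \<or> uncrossing_partner n S D c x"
    and D': "D' = recolor n S (D(b := D x, x := D b))"
    unfolding corrective_flip_def by blast
  have b: "b \<in> shape" using viol by (simp add: violates_distinguished_def)
  let ?p = "below_pipe D b" and ?q = "right_pipe D b"
  have pq: "?p < ?q"
    using viol length_drops_iff[OF b] by (simp add: violates_distinguished_def)
  have pb: "pipes_at n S D b = {?p, ?q}" by (auto simp: pipes_at_def)
  have c: "c \<in> shape" "is_stone D c" "box_before c b" "pipes_at n S D c = {?p, ?q}"
    using last pb by (auto simp: last_crossing_def is_crossing_def)
  have cb: "rd c < rd b" using box_before_rd_less c b by blast
  note inv_cb = inverted_since_last_crossing[OF b pq last]
  have nb: "\<not> is_stone D b" using plus by (simp add: is_stone_def)
  from x show ?thesis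
  proof
    assume "x = c"
    with D' have "\<forall>a\<in>shape. is_stone D' a \<longleftrightarrow>
        (if a = c then is_stone D b else if a = b then is_stone D c else is_stone D a)"
      by (simp add: is_stone_exchange)
    then show ?thesis
      using potential_exchange_less[OF c(1) b cb pq c(4) pb _ _ inv_cb] c(2) nb by blast
  next
    assume d: "uncrossing_partner n S D c x"
    then have x: "x \<in> shape" "is_stone D x" "box_before c x" "pipes_at n S D x = {?p, ?q}"
      using c by (auto simp: uncrossing_partner_def)
    have cx: "rd c < rd x" using box_before_rd_less x c by blast
    \<comment> \<open>A partner read between \<open>c\<close> and \<open>b\<close> would be a stone
      at which the inverted pair gets back in order, contrary to the inversion throughout that
      interval.\<close>
    have bx: "rd b < rd x"
    proof (rule ccontr)
      assume "\<not> rd b < rd x"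
      moreover have "rd b \<noteq> rd x" using inj_onD[OF rd_inj _ b x(1)] nb x(2) by blast
      ultimately have xb: "rd x < rd b" by simp
      obtain i where i: "rd x = Suc i" using pred_rd[OF x(1)] .
      have "inverted (partial_prod D i) ?p ?q" using inv_cb[of i] cx xb i by simp
      moreover have "right_pipe D x = ?p \<and> below_pipe D x = ?q \<or> right_pipe D x = ?q \<and> below_pipe D x = ?p"
        using x(4) by (auto simp: pipes_at_def doubleton_eq_iff)
      ultimately have "right_pipe D x = ?q" "below_pipe D x = ?p"
        using not_inverted_at_box[OF x(1) i, of D] by auto
      moreover have "inverted (partial_prod D (Suc i)) ?p ?q" using inv_cb[of "Suc i"] cx xb i by simp
      then have "inverted (partial_prod D i \<circ> simple_transp (lab x)) ?p ?q"
        using partial_prod_Suc[OF x(1) i, of D] x(2) by simp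
      moreover have "\<not> inverted (partial_prod D i \<circ> simple_transp (lab x)) (below_pipe D x) (right_pipe D x)"
        using not_inverted_comp_simple_transp[OF bij_partial_prod, of D i "lab x"]
        by (simp only: partial_prod_at_box[OF x(1) i] simp_thms)
      ultimately show False by simp
    qed
    \<comment> \<open>The pair is inverted on entering \<open>b\<close>. Losing the inversion before
      \<open>x\<close> would need a stone on both pipes after \<open>c\<close> and before
      \<open>x\<close>, but \<open>x\<close> is the first such stone.\<close>
    have inv_bx: "inverted (partial_prod D j) ?p ?q" if j: "rd b \<le> j" "j < rd x" for j
    proof (rule ccontr)
      assume not: "\<not> ?thesis"
      obtain i where i: "rd b = Suc i" using pred_rd[OF b] .
      have "i \<le> j" "j \<le> card shape" using i j rd_range[OF x(1)] by auto
      from stops_inverted_between[OF this inverted_at_box[OF b i] not]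
      obtain e where e: "e \<in> shape" "i < rd e" "rd e \<le> j" "is_stone D e"
        "right_pipe D e = ?q" "below_pipe D e = ?p" .
      have pe: "pipes_at n S D e = pipes_at n S D c" using e c by (auto simp: pipes_at_def)
      have "box_before c e"
        using same_pipes_box_before[OF c(1) e(1) _ pe[symmetric]] e(2) i cb by simp
      then have "e = x \<or> box_before x e" using d e pe unfolding uncrossing_partner_def by blast
      then have "rd x \<le> rd e" using box_before_rd_less[OF x(1) e(1)] by auto
      with e(3) j show False by simp
    qed
    from D' have "\<forall>a\<in>shape. is_stone D' a \<longleftrightarrow>
        (if a = b then is_stone D x else if a = x then is_stone D b else is_stone D a)"
      by (simp add: is_stone_exchange)
    then show ?thesis
      using potential_exchange_less[OF b x(1) bx pq pb x(4) _ _ inv_bx] x(2) nb by blast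
  qed
qed

lemma no_infinite_flip_sequence:
  "\<not> (\<forall>i. corrective_flip n k S rd (F i) (F (Suc i)))"
proof
  assume flips: "\<forall>i. corrective_flip n k S rd (F i) (F (Suc i))"
  have "i \<le> potential (F i)" for i
  proof (induction i)
    case (Suc i)
    then show ?case using potential_corrective_flip[of "F i" "F (Suc i)"] flips
      by (meson Suc_leI le_less_trans)
  qed simp
  \<comment> \<open>One more than the bound on the potential, which is the same for all diagrams on
    the shape.\<close>
  from this[of "Suc (\<Sum>j\<le>card shape. \<Sum>i\<in>{1..n}. i * n)"]
  show False using potential_bounded by (meson Suc_n_not_le_n le_trans)
qed

section \<open>Recoloring, and diagrams that admit no flip\<close>

lemma is_crossing_cong:
  assumes "is_stone D = is_stone D'"
  shows "is_crossing n S D b \<longleftrightarrow> is_crossing n S D' b"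
proof (cases "b \<in> shape")
  case True
  then obtain j where j: "rd b = Suc j" using pred_rd by metis
  have "partial_prod D j = partial_prod D' j" using assms by (intro partial_prod_cong) simp
  then have "right_pipe D b = right_pipe D' b" "below_pipe D b = below_pipe D' b"
    by (simp_all flip: partial_prod_at_box[OF True j])
  then show ?thesis using assms by (simp add: is_crossing_def)
qed (simp add: is_crossing_def)

text \<open>Pipes pass through stones of either color alike, so crossings computed before recoloring
  are still correct afterwards.\<close>

lemma stones_colored_recolor: "stones_colored n S (recolor n S D)"
proof -
  have "is_crossing n S (recolor n S D) b \<longleftrightarrow> is_crossing n S D b" for b
    by (intro is_crossing_cong) (simp add: fun_eq_iff)
  then show ?thesis
    by (simp add: stones_colored_def is_uncrossing_def) (simp add: recolor_def is_uncrossing_def)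
qed

lemma stones_colored_reachable:
  assumes "(corrective_flip n k S rd)\<^sup>*\<^sup>* D D'" and "stones_colored n S D"
  shows "stones_colored n S D'"
  using assms by (induction) (auto simp: corrective_flip_def stones_colored_recolor)

text \<open>At a stone, correct coloring is already the Go condition, as the two entering pipes
  differ. At a violating plus a last crossing \<open>c\<close> exists, and the exchange with
  \<open>c\<close> itself is always a legal flip.\<close>

lemma go_diagram_if_no_flip:
  assumes colored: "stones_colored n S D" and stuck: "\<not> (\<exists>D'. corrective_flip n k S rd D D')"
  shows "go_diagram n k S rd D"
  unfolding go_diagram_def
proof
  fix b assume b: "b \<in> shape"
  have stone: "D b = Black \<longleftrightarrow> length_drops n k S rd D b" if "is_stone D b"
    using that b colored right_pipe_neq_below_pipe[OF b, of D]
    by (auto simp: stones_colored_def is_uncrossing_def is_crossing_def length_drops_iff)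
  show "D b = Black \<longleftrightarrow> length_drops n k S rd D b"
  proof (cases "is_stone D b")
    case False
    then have plus: "D b = Plus" by (simp add: is_stone_def)
    have "\<not> length_drops n k S rd D b"
    proof
      assume drops: "length_drops n k S rd D b"
      then obtain c where "last_crossing n S D b c"
        using last_crossing_exists[OF b] length_drops_iff[OF b] by blast
      moreover have "violates_distinguished n k S rd D b"
        using b plus drops by (simp add: violates_distinguished_def)
      ultimately show False using stuck plus unfolding corrective_flip_def by blast
    qed
    with plus show ?thesis by simp
  qed (rule stone)
qed

end

theorem mainTheorem4:
  fixes n k :: nat and S :: "nat set" and rd :: "box \<Rightarrow> nat" and D :: diagram
  assumes "0 < k" and "k < n"
    and "lattice_path n k S"
    and "reading_order n S rd"
    and "stones_colored n S D"
  shows "\<not> (\<exists>F. F 0 = D \<and> (\<forall>i::nat. corrective_flip n k S rd (F i) (F (Suc i)))) \<and>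
    (\<forall>D'. (corrective_flip n k S rd)\<^sup>*\<^sup>* D D' \<and> \<not> (\<exists>D''. corrective_flip n k S rd D' D'')
           \<longrightarrow> go_diagram n k S rd D')"
proof -
  interpret ordered_shape n k S rd
    by unfold_locales (fact assms)+
  show ?thesis
    using no_infinite_flip_sequence go_diagram_if_no_flip stones_colored_reachable assms(5) by blast
qed

end
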